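(* For every non-negative integer $n$, $$\sum_{k=0}^n(-1)^k\binom{2k}k\binom{2(n-k)}{n-k}=\begin{cases}2^n\binom n{n/2}, & \text{if } n\text{ is even},\\ 0, & \text{if } n\text{ is odd}.\end{cases}$$ *)

theory Defs
  imports Main
begin

end

theory Submission
  imports Defs "HOL-Computational_Algebra.Formal_Power_Series"
begin

unbundle fps_syntax

text \<open>The generating function \<open>C(X)\<close> of the central binomial coefficients satisfies
  \<open>(1 - 4 X) C' = 2 C\<close>. Hence \<open>P(X) = C(-X) C(X)\<close> satisfies \<open>(1 - 16 X\<^sup>2) P' = 16 X P\<close>,
  a two-step recurrence for its coefficients, which the right-hand side satisfies as well.\<close>

lemma Suc_mult_central_binomial:
  "Suc k * (2 * Suc k choose Suc k) = 2 * (2 * k + 1) * (2 * k choose k)"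
proof -
  have "Suc k * (Suc (Suc (2 * k)) choose Suc k) = Suc (Suc (2 * k)) * (Suc (2 * k) choose k)"
    by (rule Suc_times_binomial)
  \<comment> \<open>By symmetry the lower index becomes \<open>Suc k\<close>; the factor
    \<open>Suc k\<close> split off from \<open>2 * k + 2\<close> then lets the absorption identity
    apply a second time.\<close>
  also have "Suc (2 * k) choose k = Suc (2 * k) choose Suc k"
    by (subst binomial_symmetric) auto
  also have "Suc (Suc (2 * k)) * \<dots> = 2 * (Suc k * (Suc (2 * k) choose Suc k))"
    by simp
  also have "Suc k * (Suc (2 * k) choose Suc k) = Suc (2 * k) * (2 * k choose k)"
    by (rule Suc_times_binomial)
  finally show ?thesis by simp
qed

text \<open>This is C(cX); the parameter \<open>c\<close> lets one differential equation serve both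
  factors C(-X) and C(X).\<close>

definition central_binomial_fps :: "int \<Rightarrow> int fps" where
  "central_binomial_fps c = Abs_fps (\<lambda>k. c ^ k * int (2 * k choose k))"

lemma central_binomial_fps_deriv:
  "(1 - fps_const (4 * c) * fps_X) * fps_deriv (central_binomial_fps c)
     = fps_const (2 * c) * central_binomial_fps c"
proof (rule fps_ext)
  fix n
  have rec: "int (Suc k) * int (2 * Suc k choose Suc k) = 2 * (2 * int k + 1) * int (2 * k choose k)" for k
    using arg_cong[OF Suc_mult_central_binomial[of k], of int] by (simp add: algebra_simps)
  have coeff: "fps_deriv (central_binomial_fps c) $ k
      = c ^ Suc k * (2 * (2 * int k + 1) * int (2 * k choose k))" for k
    unfolding rec[symmetric] by (simp add: central_binomial_fps_def del: binomial_Suc_Suc)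
  have "((1 - fps_const (4 * c) * fps_X) * fps_deriv (central_binomial_fps c)) $ n
      = fps_deriv (central_binomial_fps c) $ n
        - 4 * c * (if n = 0 then 0 else fps_deriv (central_binomial_fps c) $ (n - 1))"
    by (simp add: left_diff_distrib mult.assoc)
  \<comment> \<open>The factor \<open>n\<close> absorbs the case \<open>n = 0\<close>. What remains
    to compare is 2(2n + 1) - 4n = 2.\<close>
  also have "(if n = 0 then 0 else fps_deriv (central_binomial_fps c) $ (n - 1))
      = int n * (c ^ n * int (2 * n choose n))"
    by (cases n) (simp_all add: central_binomial_fps_def)
  also have "fps_deriv (central_binomial_fps c) $ n - 4 * c * (int n * (c ^ n * int (2 * n choose n)))
      = (fps_const (2 * c) * central_binomial_fps c) $ n"
    unfolding coeff by (simp add: central_binomial_fps_def algebra_simps)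
  finally show "((1 - fps_const (4 * c) * fps_X) * fps_deriv (central_binomial_fps c)) $ n
      = (fps_const (2 * c) * central_binomial_fps c) $ n" .
qed

lemma central_binomial_fps_prod_deriv:
  defines "P \<equiv> central_binomial_fps (- 1) * central_binomial_fps 1"
  shows "fps_deriv P - 16 * fps_X * (fps_X * fps_deriv P) = 16 * fps_X * P"
proof -
  define A B where "A = central_binomial_fps (- 1)" and "B = central_binomial_fps 1"
  have A: "(1 + 4 * fps_X) * fps_deriv A = - 2 * A"
    using central_binomial_fps_deriv[of "- 1"]
    by (simp add: A_def numeral_fps_const flip: fps_const_neg)
  have B: "(1 - 4 * fps_X) * fps_deriv B = 2 * B"
    using central_binomial_fps_deriv[of 1] by (simp add: B_def numeral_fps_const)
  \<comment> \<open>Product rule and 1 - 16 X^2 = (1 - 4X)(1 + 4X): each derivative meets the factor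
    of its own equation. The sum is then (-2(1 - 4X) + 2(1 + 4X)) A B = 16 X A B.\<close>
  have "fps_deriv P - 16 * fps_X * (fps_X * fps_deriv P)
      = (1 - 4 * fps_X) * B * ((1 + 4 * fps_X) * fps_deriv A)
        + (1 + 4 * fps_X) * A * ((1 - 4 * fps_X) * fps_deriv B)"
    by (simp add: P_def A_def[symmetric] B_def[symmetric] algebra_simps)
  also have "\<dots> = 16 * fps_X * P"
    unfolding A B by (simp add: P_def A_def[symmetric] B_def[symmetric] algebra_simps)
  finally show ?thesis .
qed

theorem theorem5:
  fixes n :: nat
  shows "(\<Sum>k=0..n. (- 1 :: int) ^ k * int ((2 * k) choose k) * int ((2 * (n - k)) choose (n - k)))
       = (if even n then 2 ^ n * int (n choose (n div 2)) else 0)"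
proof -
  define P where "P = central_binomial_fps (- 1) * central_binomial_fps 1"
  have ode: "fps_deriv P - fps_const 16 * (fps_X * (fps_X * fps_deriv P)) = fps_const 16 * (fps_X * P)"
    using central_binomial_fps_prod_deriv by (simp add: P_def numeral_fps_const mult.assoc)
  have P_nth: "P $ m = (\<Sum>k=0..m. (- 1) ^ k * int (2 * k choose k) * int (2 * (m - k) choose (m - k)))" for m
    by (simp add: P_def central_binomial_fps_def fps_mult_nth)
  \<comment> \<open>At X^(m+1) the equation reads (m + 2) P_(m+2) - 16 m P_m = 16 P_m.\<close>
  have rec: "int (m + 2) * P $ (m + 2) = 16 * int (m + 1) * P $ m" for m
    using arg_cong[OF ode, of "\<lambda>f. f $ Suc m"] by (cases m) (simp_all add: algebra_simps)
  have even: "P $ (2 * j) = 2 ^ (2 * j) * int (2 * j choose j)" for j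
  proof (induction j)
    case 0
    show ?case by (simp add: P_nth)
  next
    case (Suc j)
    have "int (2 * Suc j) * P $ (2 * Suc j) = 16 * int (2 * j + 1) * (2 ^ (2 * j) * int (2 * j choose j))"
      using rec[of "2 * j"] by (simp add: Suc.IH)
    \<comment> \<open>Splitting 16 as 2 * 4 * 2 isolates the right-hand side of
      \<open>Suc_mult_central_binomial\<close>; the nonzero factor \<open>2 * Suc j\<close> cancels
      at the end.\<close>
    also have "\<dots> = 2 * 2 ^ (2 * Suc j) * int (2 * (2 * j + 1) * (2 * j choose j))"
      by (simp add: algebra_simps)
    also have "\<dots> = int (2 * Suc j) * (2 ^ (2 * Suc j) * int (2 * Suc j choose Suc j))"
      unfolding Suc_mult_central_binomial[symmetric] of_nat_mult by (simp only: of_nat_numeral ac_simps)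
    finally show ?case by (simp del: binomial_Suc_Suc)
  qed
  \<comment> \<open>The base value is 2 - 2 = 0, and the homogeneous recurrence carries zero from
    each odd index to the next.\<close>
  have odd: "P $ (2 * j + 1) = 0" for j
  proof (induction j)
    case 0
    show ?case by (simp add: P_nth)
  next
    case (Suc j)
    then show ?case using rec[of "2 * j + 1"] by simp
  qed
  have "P $ n = (if even n then 2 ^ n * int (n choose (n div 2)) else 0)"
    using even[of "n div 2"] odd[of "n div 2"] by (auto elim!: evenE oddE)
  then show ?thesis by (simp only: P_nth)
qed

end
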